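(* Let $n\ge2$, $0<m<n$, and let $f:\mathbb{R}^n\to\mathbb{R}^m$ be smooth with Jacobian $J(x)$ of full rank $m$ for every $x\in\mathbb{R}^n$. With $T$, $N$, $N'_\perp$, $N'_\|$ as in the context, let $(x(t),v(t))$, $t\ge0$, be a solution of $$\frac{d}{dt}x=T(x)v,\qquad \frac{d}{dt}v=\Bigl(N'_\|(x)\bigl[(T(x)-N(x))v\bigr]-N'_\perp(x)\bigl[(T(x)-N(x))v\bigr]\Bigr)v,$$ and write $v_\|(t)=T(x(t))v(t)$, $v_\perp(t)=N(x(t))v(t)$. For $\delta>0$ and integers $k\ge0$ set $$X_k=x(k\delta),\qquad V_k=v_\|(k\delta)+(-1)^kv_\perp(k\delta),$$ and define the truncation errors $$\sigma_{k+1}=X_{k+1}-X_k-\delta\,T\bigl(X_k+(\delta/2)V_k\bigr)V_k,\qquad \tau_{k+1}=V_{k+1}-\bigl(I-2N(X_k+(\delta/2)V_k)\bigr)V_k.$$ Then, for each $t\ge 0$, as $\delta\to0$ and $k\to\infty$ with $k\delta\to t$, the truncation errors satisfy $\sigma_k=\mathcal{O}(\delta^2)$ and $\tau_k=\mathcal{O}(\delta^2)$.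
   Context: $J(x)$ is the $m\times n$ Jacobian of $f$ at $x$; $J(x)^+=J(x)^\top(J(x)J(x)^\top)^{-1}$; $N(x)=J(x)^+J(x)$ is the orthogonal projection onto the orthogonal complement of $\ker J(x)$; $T(x)=I-N(x)$ is the orthogonal projection onto $\ker J(x)$. $H(x):\mathbb{R}^n\times\mathbb{R}^n\to\mathbb{R}^m$ is the second derivative of $f$ at $x$ (the $i$-th component of $H(x)[u,w]$ is $u^\top\nabla^2f_i(x)w$), and $H(x)[w,\cdot]$ is the $m\times n$ matrix of the linear map $z\mapsto H(x)[w,z]$. For $x,w\in\mathbb{R}^n$ define the $n\times n$ matrices $$N'_\perp(x)[w]=J(x)^+H(x)[w,\cdot]\,T(x),\qquad N'_\|(x)[w]=\bigl(N'_\perp(x)[w]\bigr)^\top.$$ (By a result of Golub and Pereyra, the derivative $N'(x)[w]$ of $N$ at $x$ in the direction $w$ equals $N'_\perp(x)[w]+N'_\|(x)[w]$.) The residuals $\sigma_{k+1},\tau_{k+1}$ are those obtained by substituting $X_k,V_k$ into the algorithm $x_{k+1}=x_k+\delta T(x_k+(\delta/2)v_k)v_k$, $v_{k+1}=(I-2N(x_k+(\delta/2)v_k))v_k$. *)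

theory Defs
  imports "HOL-Analysis.Analysis" "HOL-Library.Landau_Symbols"
begin

primrec Ck_differentiable :: "nat \<Rightarrow> ('a::real_normed_vector \<Rightarrow> 'b::real_normed_vector) \<Rightarrow> bool" where
  "Ck_differentiable 0 f \<longleftrightarrow> continuous_on UNIV f"
| "Ck_differentiable (Suc k) f \<longleftrightarrow>
     (\<forall>x. f differentiable (at x)) \<and> (\<forall>u. Ck_differentiable k (\<lambda>x. frechet_derivative f (at x) u))"

text \<open>On a finite-dimensional domain this is the usual notion of a \<open>C\<^sup>\<infinity>\<close> map, since
  continuity of all directional derivatives of order \<open>k\<close> amounts to continuity of the
  \<open>k\<close>-th Frechet derivative.\<close>
definition smooth :: "('a::real_normed_vector \<Rightarrow> 'b::real_normed_vector) \<Rightarrow> bool" where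
  "smooth f \<longleftrightarrow> (\<forall>k. Ck_differentiable k f)"

definition Jac :: "(real^'n \<Rightarrow> real^'m) \<Rightarrow> real^'n \<Rightarrow> real^'n^'m" where
  "Jac f x = jacobian f (at x)"

text \<open>The Moore-Penrose inverse of the Jacobian, given by this formula when the Jacobian has full
  row rank.\<close>
definition Jac_pinv :: "(real^'n \<Rightarrow> real^'m) \<Rightarrow> real^'n \<Rightarrow> real^'m^'n" where
  "Jac_pinv f x = transpose (Jac f x) ** matrix_inv (Jac f x ** transpose (Jac f x))"

definition Nproj :: "(real^'n \<Rightarrow> real^'m) \<Rightarrow> real^'n \<Rightarrow> real^'n^'n" where
  "Nproj f x = Jac_pinv f x ** Jac f x"

definition Tproj :: "(real^'n \<Rightarrow> real^'m) \<Rightarrow> real^'n \<Rightarrow> real^'n^'n" where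
  "Tproj f x = mat 1 - Nproj f x"

definition hessian :: "(real^'n \<Rightarrow> real) \<Rightarrow> real^'n \<Rightarrow> real^'n^'n" where
  "hessian g x =
     (\<chi> a b. frechet_derivative (\<lambda>y. frechet_derivative g (at y) (axis b 1)) (at x) (axis a 1))"

definition Hbil :: "(real^'n \<Rightarrow> real^'m) \<Rightarrow> real^'n \<Rightarrow> real^'n \<Rightarrow> real^'n \<Rightarrow> real^'m" where
  "Hbil f x u w = (\<chi> i. u \<bullet> (hessian (\<lambda>y. f y $ i) x *v w))"

definition dN_perp :: "(real^'n \<Rightarrow> real^'m) \<Rightarrow> real^'n \<Rightarrow> real^'n \<Rightarrow> real^'n^'n" where
  "dN_perp f x w = Jac_pinv f x ** matrix (Hbil f x w) ** Tproj f x"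

definition dN_par :: "(real^'n \<Rightarrow> real^'m) \<Rightarrow> real^'n \<Rightarrow> real^'n \<Rightarrow> real^'n^'n" where
  "dN_par f x w = transpose (dN_perp f x w)"

text \<open>The filter of pairs \<open>(\<delta>, k)\<close> expressing \<open>\<delta> \<rightarrow> 0\<close>, \<open>\<delta> > 0\<close>, and \<open>k \<rightarrow> \<infinity>\<close> with \<open>k \<delta> \<rightarrow> t\<close>.\<close>
definition step_filter :: "real \<Rightarrow> (real \<times> nat) filter" where
  "step_filter t =
     inf (at_right 0 \<times>\<^sub>F sequentially) (filtercomap (\<lambda>(\<delta>, k). real k * \<delta>) (nhds t))"

lemma eventually_step_filter:
  "eventually P (step_filter t) \<longleftrightarrow>
     (\<exists>\<epsilon>>0. \<exists>K. \<forall>\<delta> k. 0 < \<delta> \<and> \<delta> < \<epsilon> \<and> K \<le> k \<and> \<bar>real k * \<delta> - t\<bar> < \<epsilon> \<longrightarrow> P (\<delta>, k))"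
    (is "?L \<longleftrightarrow> ?R")
proof
  assume ?L
  then obtain Q R where Q: "eventually Q (at_right (0::real) \<times>\<^sub>F sequentially)"
    and R: "eventually R (filtercomap (\<lambda>(\<delta>, k). real k * \<delta>) (nhds t))"
    and QR: "\<And>p. Q p \<Longrightarrow> R p \<Longrightarrow> P p"
    unfolding step_filter_def eventually_inf by blast
  from Q obtain A B where A: "eventually A (at_right (0::real))" and B: "eventually B sequentially"
    and AB: "\<And>a b. A a \<Longrightarrow> B b \<Longrightarrow> Q (a, b)"
    unfolding eventually_prod_filter by blast
  from A obtain e1 where e1: "e1 > 0" "\<And>d. 0 < d \<Longrightarrow> d < e1 \<Longrightarrow> A d"
    unfolding eventually_at_right_field by auto
  from B obtain K where K: "\<And>k. K \<le> k \<Longrightarrow> B k"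
    unfolding eventually_sequentially by auto
  from R obtain S where S: "eventually S (nhds t)" and SR: "\<And>d k. S (real k * d) \<Longrightarrow> R (d, k)"
    unfolding eventually_filtercomap by auto
  from S obtain e2 where e2: "e2 > 0" "\<And>s. \<bar>s - t\<bar> < e2 \<Longrightarrow> S s"
    unfolding eventually_nhds_metric dist_real_def by auto
  have "P (d, k)" if "0 < d" "d < min e1 e2" "K \<le> k" "\<bar>real k * d - t\<bar> < min e1 e2" for d k
  proof (rule QR)
    show "Q (d, k)" by (rule AB) (use e1(2)[of d] K that in simp_all)
    show "R (d, k)" by (rule SR, rule e2(2)) (use that in simp)
  qed
  moreover have "min e1 e2 > 0" using e1(1) e2(1) by simp
  ultimately show ?R by blast
next
  assume ?R
  then obtain e K where e: "e > 0"
    and P: "\<And>d k. 0 < d \<Longrightarrow> d < e \<Longrightarrow> K \<le> k \<Longrightarrow> \<bar>real k * d - t\<bar> < e \<Longrightarrow> P (d, k)"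
    by blast
  have "eventually (\<lambda>p. 0 < fst p \<and> fst p < e \<and> K \<le> snd p) (at_right (0::real) \<times>\<^sub>F sequentially)"
  proof -
    have "eventually (\<lambda>d. 0 < d \<and> d < e) (at_right (0::real))"
      using e unfolding eventually_at_right_field by auto
    from eventually_prodI[OF this eventually_ge_at_top[of K]]
    show ?thesis by simp
  qed
  moreover have "eventually (\<lambda>p. \<bar>real (snd p) * fst p - t\<bar> < e)
      (filtercomap (\<lambda>(\<delta>, k). real k * \<delta>) (nhds t))"
    unfolding eventually_filtercomap
  proof (intro exI conjI allI impI)
    show "eventually (\<lambda>s. \<bar>s - t\<bar> < e) (nhds t)"
      unfolding eventually_nhds_metric dist_real_def using e by blast
  qed (simp add: split_beta)
  moreover have "P p" if "0 < fst p \<and> fst p < e \<and> K \<le> snd p" "\<bar>real (snd p) * fst p - t\<bar> < e" for p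
    using P[of "fst p" "snd p"] that by simp
  ultimately show ?L
    unfolding step_filter_def eventually_inf by (intro exI conjI allI impI) (assumption | blast)+
qed

end

theory Submission
  imports Defs
begin

text \<open>
  Let \<open>A[w]\<close> stand for \<open>dN_perp f x w\<close>. The Golub--Pereyra formula
  \<open>N'[w] = A[w] + A[w]\<^sup>T\<close> follows by differentiating \<open>N = J\<^sup>T (J J\<^sup>T)\<^sup>-\<^sup>1 J\<close>. Along a solution it
  turns the ODE into equations for the two parts \<open>p = T v\<close> and \<open>q = N v\<close> of the velocity,
  \<open>q' = A[q] v + A[p]\<^sup>T v\<close> and \<open>p' = - A[q]\<^sup>T v - A[p] v\<close>. For \<open>V = p + \<epsilon> q\<close> with \<open>\<epsilon>\<^sup>2 = 1\<close>, the
  relations \<open>A T = A\<close>, \<open>A\<^sup>T N = A\<^sup>T\<close> give \<open>N'[V] V = - (p' - \<epsilon> q')\<close>, so the first-order terms of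
  the reflection step and of \<open>p - \<epsilon> q\<close> agree, and only second-order remainders are left. These are
  controlled uniformly because every map involved has a derivative that is Lipschitz on bounded sets.
\<close>

subsection \<open>Maps that are Lipschitz on bounded sets\<close>

text \<open>This class, unlike that of globally Lipschitz maps, is closed under products, while
  still giving one constant per bounded region. The domain \<open>S\<close> is a parameter because
  the solution curves are controlled only for nonnegative times.\<close>

definition bdd_lipschitz :: "'a::real_normed_vector set \<Rightarrow> ('a \<Rightarrow> 'b::real_normed_vector) \<Rightarrow> bool" where
  "bdd_lipschitz S f \<longleftrightarrow> (\<forall>B\<subseteq>S. bounded B \<longrightarrow> (\<exists>C. C-lipschitz_on B f))"

lemma bdd_lipschitzI:
  assumes "\<And>B. B \<subseteq> S \<Longrightarrow> bounded B \<Longrightarrow> \<exists>C. C-lipschitz_on B f"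
  shows "bdd_lipschitz S f"
  using assms by (auto simp: bdd_lipschitz_def)

lemma bdd_lipschitzE:
  assumes "bdd_lipschitz S f" "B \<subseteq> S" "bounded B"
  obtains C where "C-lipschitz_on B f"
  using assms by (auto simp: bdd_lipschitz_def)

lemma bdd_lipschitz_bounded_image:
  assumes "bdd_lipschitz S f" "B \<subseteq> S" "bounded B"
  shows "bounded (f ` B)"
proof -
  obtain C where C: "C-lipschitz_on B f" using assms by (rule bdd_lipschitzE)
  obtain e where e: "\<And>x y. x \<in> B \<Longrightarrow> y \<in> B \<Longrightarrow> dist x y \<le> e"
    using \<open>bounded B\<close> by (auto simp: bounded_two_points)
  have "dist (f x) (f y) \<le> C * e" if "x \<in> B" "y \<in> B" for x y
    using lipschitz_onD[OF C that] mult_left_mono[OF e[OF that] lipschitz_on_nonneg[OF C]] by simp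
  then show ?thesis by (auto simp: bounded_two_points)
qed

lemma bdd_lipschitz_bound:
  assumes "bdd_lipschitz S f" "B \<subseteq> S" "bounded B"
  obtains b where "b > 0" "\<And>x. x \<in> B \<Longrightarrow> norm (f x) \<le> b"
  using bdd_lipschitz_bounded_image[OF assms] by (auto simp: bounded_pos)

lemma bdd_lipschitz_const: "bdd_lipschitz S (\<lambda>x. c)"
  by (intro bdd_lipschitzI exI) (rule lipschitz_on_constant)

lemma bdd_lipschitz_compose:
  assumes "bdd_lipschitz T g" "bdd_lipschitz S f" "f ` S \<subseteq> T"
  shows "bdd_lipschitz S (\<lambda>x. g (f x))"
proof (rule bdd_lipschitzI)
  fix B assume B: "B \<subseteq> S" "bounded B"
  obtain C where "C-lipschitz_on B f" using assms(2) B by (rule bdd_lipschitzE)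
  moreover obtain D where "D-lipschitz_on (f ` B) g"
    using bdd_lipschitzE[OF assms(1) _ bdd_lipschitz_bounded_image[OF assms(2) B]] assms(3) B
    by blast
  ultimately show "\<exists>C. C-lipschitz_on B (\<lambda>x. g (f x))"
    using lipschitz_on_compose2 by blast
qed

lemma bdd_lipschitz_add:
  assumes "bdd_lipschitz S f" "bdd_lipschitz S g"
  shows "bdd_lipschitz S (\<lambda>x. f x + g x)"
  using assms unfolding bdd_lipschitz_def by (blast intro: lipschitz_on_add)

lemma bdd_lipschitz_Pair:
  assumes "bdd_lipschitz S f" "bdd_lipschitz S g"
  shows "bdd_lipschitz S (\<lambda>x. (f x, g x))"
  using assms unfolding bdd_lipschitz_def by (blast intro: lipschitz_on_Pair)

lemma bdd_lipschitz_sum: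
  assumes "\<And>i. i \<in> I \<Longrightarrow> bdd_lipschitz S (f i)"
  shows "bdd_lipschitz S (\<lambda>x. \<Sum>i\<in>I. f i x)"
  using assms
  by (induction I rule: infinite_finite_induct)
    (auto intro: bdd_lipschitz_const bdd_lipschitz_add)

lemma bdd_lipschitz_bounded_linear:
  assumes "bounded_linear T"
  shows "bdd_lipschitz S T"
proof -
  interpret bounded_linear T by fact
  obtain K where "K \<ge> 0" "\<And>x. norm (T x) \<le> norm x * K" using nonneg_bounded by blast
  then have "K-lipschitz_on B T" for B
    by (intro lipschitz_onI) (simp_all add: dist_norm diff[symmetric] mult.commute)
  then show ?thesis by (auto intro: bdd_lipschitzI)
qed

lemma bdd_lipschitz_linear:
  assumes "bounded_linear T" "bdd_lipschitz S f"
  shows "bdd_lipschitz S (\<lambda>x. T (f x))"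
  by (rule bdd_lipschitz_compose[OF bdd_lipschitz_bounded_linear assms(2)]) (use assms in auto)

lemma bdd_lipschitz_scaleR:
  assumes "bdd_lipschitz S f"
  shows "bdd_lipschitz S (\<lambda>x. c *\<^sub>R f x)"
  by (rule bdd_lipschitz_linear[OF bounded_linear_scaleR_right assms])

lemma bdd_lipschitz_diff:
  assumes "bdd_lipschitz S f" "bdd_lipschitz S g"
  shows "bdd_lipschitz S (\<lambda>x. f x - g x)"
  using assms unfolding bdd_lipschitz_def by (blast intro: lipschitz_on_diff)

lemma bdd_lipschitz_minus:
  assumes "bdd_lipschitz S f"
  shows "bdd_lipschitz S (\<lambda>x. - f x)"
  using assms unfolding bdd_lipschitz_def by (blast intro: lipschitz_on_minus)

text \<open>The difference of two products splits as in the product rule. Each summand pairs an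
  increment of one factor with a value of the other, and values are bounded on bounded sets.\<close>

lemma bdd_lipschitz_bilinear:
  assumes "bounded_bilinear pr" "bdd_lipschitz S f" "bdd_lipschitz S g"
  shows "bdd_lipschitz S (\<lambda>x. pr (f x) (g x))"
proof (rule bdd_lipschitzI)
  interpret bounded_bilinear pr by fact
  fix B assume B: "B \<subseteq> S" "bounded B"
  obtain K where K: "K > 0" "\<And>a b. norm (pr a b) \<le> norm a * norm b * K" using pos_bounded by blast
  obtain C where C: "C-lipschitz_on B f" using assms(2) B by (rule bdd_lipschitzE)
  obtain D where D: "D-lipschitz_on B g" using assms(3) B by (rule bdd_lipschitzE)
  obtain c where c: "c > 0" "\<And>x. x \<in> B \<Longrightarrow> norm (f x) \<le> c"
    using assms(2) B by (rule bdd_lipschitz_bound) blast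
  obtain d where d: "d > 0" "\<And>x. x \<in> B \<Longrightarrow> norm (g x) \<le> d"
    using assms(3) B by (rule bdd_lipschitz_bound) blast
  have "dist (pr (f x) (g x)) (pr (f y) (g y)) \<le> (C * d * K + c * D * K) * dist x y"
    if xy: "x \<in> B" "y \<in> B" for x y
  proof -
    have "pr (f x) (g x) - pr (f y) (g y) = pr (f x - f y) (g x) + pr (f y) (g x - g y)"
      by (simp add: diff_left diff_right)
    then have "dist (pr (f x) (g x)) (pr (f y) (g y))
        \<le> norm (pr (f x - f y) (g x)) + norm (pr (f y) (g x - g y))"
      by (simp add: dist_norm norm_triangle_ineq)
    also have "\<dots> \<le> norm (f x - f y) * norm (g x) * K + norm (f y) * norm (g x - g y) * K"
      by (intro add_mono K)
    also have "\<dots> \<le> (C * norm (x - y)) * d * K + c * (D * norm (x - y)) * K"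
      using lipschitz_on_normD[OF C xy] lipschitz_on_normD[OF D xy] c d xy K(1)
        lipschitz_on_nonneg[OF C] lipschitz_on_nonneg[OF D]
      by (intro add_mono mult_mono) (auto intro!: mult_nonneg_nonneg)
    finally show ?thesis by (simp add: dist_norm algebra_simps)
  qed
  moreover have "0 \<le> C * d * K + c * D * K"
    using lipschitz_on_nonneg[OF C] lipschitz_on_nonneg[OF D] c(1) d(1) K(1) by simp
  ultimately show "\<exists>C. C-lipschitz_on B (\<lambda>x. pr (f x) (g x))"
    by (blast intro: lipschitz_onI)
qed

text \<open>The Euclidean distance is at most the sum of the coordinate distances, so the coordinate
  constants may be added.\<close>

lemma bdd_lipschitz_vec:
  fixes f :: "'a::real_normed_vector \<Rightarrow> 'b::real_normed_vector^'n"
  assumes "\<And>i. bdd_lipschitz S (\<lambda>x. f x $ i)"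
  shows "bdd_lipschitz S f"
proof (rule bdd_lipschitzI)
  fix B assume B: "B \<subseteq> S" "bounded B"
  have "\<forall>i. \<exists>C. C-lipschitz_on B (\<lambda>x. f x $ i)"
    using assms B by (meson bdd_lipschitzE)
  then obtain C where C: "\<And>i. (C i)-lipschitz_on B (\<lambda>x. f x $ i)" by metis
  have "dist (f x) (f y) \<le> (\<Sum>i\<in>UNIV. C i) * dist x y" if "x \<in> B" "y \<in> B" for x y
  proof -
    have "dist (f x) (f y) \<le> (\<Sum>i\<in>UNIV. dist (f x $ i) (f y $ i))"
      unfolding dist_vec_def by (rule L2_set_le_sum) simp
    also have "\<dots> \<le> (\<Sum>i\<in>UNIV. C i * dist x y)"
      using lipschitz_onD[OF C that] by (rule sum_mono)
    finally show ?thesis by (simp add: sum_distrib_right)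
  qed
  moreover have "0 \<le> (\<Sum>i\<in>UNIV. C i)"
    using lipschitz_on_nonneg[OF C] by (simp add: sum_nonneg)
  ultimately show "\<exists>C. C-lipschitz_on B f" by (blast intro: lipschitz_onI)
qed

lemma bounded_bilinear_matrix_mult:
  "bounded_bilinear ((**) :: real^'n^'m \<Rightarrow> real^'k^'n \<Rightarrow> real^'k^'m)"
  unfolding bilinear_conv_bounded_bilinear[symmetric] bilinear_def
  by (auto intro!: linearI simp: matrix_add_ldistrib matrix_matrix_mult_def vec_eq_iff
      sum.distrib[symmetric] sum_distrib_left algebra_simps)

lemma bounded_bilinear_matrix_vector_mult:
  "bounded_bilinear ((*v) :: real^'n^'m \<Rightarrow> real^'n \<Rightarrow> real^'m)"
  unfolding bilinear_conv_bounded_bilinear[symmetric] bilinear_def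
  by (auto intro!: linearI simp: matrix_vector_mult_def vec_eq_iff
      sum.distrib[symmetric] sum_distrib_left algebra_simps)

lemma bounded_linear_transpose: "bounded_linear (transpose :: real^'n^'m \<Rightarrow> real^'m^'n)"
  unfolding linear_conv_bounded_linear[symmetric]
  by (auto intro!: linearI simp: transpose_def vec_eq_iff)

lemmas bdd_lipschitz_intros =
  bdd_lipschitz_const bdd_lipschitz_add bdd_lipschitz_diff bdd_lipschitz_minus
  bdd_lipschitz_scaleR bdd_lipschitz_sum bdd_lipschitz_Pair
  bdd_lipschitz_linear[OF bounded_linear_transpose]
  bdd_lipschitz_linear[OF bounded_linear_vec_nth]
  bdd_lipschitz_bilinear[OF bounded_bilinear_matrix_mult]
  bdd_lipschitz_bilinear[OF bounded_bilinear_matrix_vector_mult]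
  bdd_lipschitz_bilinear[OF bounded_bilinear_mult]

section \<open>Smooth maps are Lipschitz on bounded sets\<close>

lemma smooth_imp_differentiable: "smooth f \<Longrightarrow> f differentiable (at x)"
  unfolding smooth_def by (metis Ck_differentiable.simps(2))

lemma smooth_frechet_derivative: "smooth f \<Longrightarrow> smooth (\<lambda>x. frechet_derivative f (at x) u)"
  unfolding smooth_def by (metis Ck_differentiable.simps(2))

lemma smooth_imp_continuous_on: "smooth f \<Longrightarrow> continuous_on UNIV f"
  unfolding smooth_def by (metis Ck_differentiable.simps(1))

text \<open>Mean value inequality on a closed ball containing \<open>B\<close>: the ball is convex,
  and its compactness bounds the derivative.\<close>

lemma smooth_imp_bdd_lipschitz:
  fixes f :: "'a::euclidean_space \<Rightarrow> 'b::real_normed_vector"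
  assumes "smooth f"
  shows "bdd_lipschitz UNIV f"
proof (rule bdd_lipschitzI)
  fix B :: "'a set" assume "bounded B"
  then obtain r where r: "B \<subseteq> cball 0 r" by (auto simp: bounded_iff subset_eq)
  \<comment> \<open>Smoothness is phrased through directional derivatives, so the operator norm is
    dominated by this continuous sum over the basis directions.\<close>
  let ?\<phi> = "\<lambda>x. \<Sum>b\<in>Basis. norm (frechet_derivative f (at x) b)"
  have "continuous_on (cball 0 r) ?\<phi>"
    by (intro continuous_intros continuous_on_subset[OF smooth_imp_continuous_on]
        smooth_frechet_derivative assms subset_UNIV)
  then have "bounded (?\<phi> ` cball 0 r)"
    by (intro compact_imp_bounded compact_continuous_image compact_cball)
  then obtain C where C: "C > 0" "\<And>x. x \<in> cball 0 r \<Longrightarrow> norm (?\<phi> x) \<le> C"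
    unfolding bounded_pos by blast
  have "onorm (frechet_derivative f (at x)) \<le> C" if x: "x \<in> cball 0 r" for x
  proof (rule onorm_le)
    fix h
    interpret bounded_linear "frechet_derivative f (at x)"
      using smooth_imp_differentiable[OF assms] frechet_derivative_works has_derivative_bounded_linear
      by blast
    have "frechet_derivative f (at x) h = (\<Sum>b\<in>Basis. (h \<bullet> b) *\<^sub>R frechet_derivative f (at x) b)"
      by (subst euclidean_representation[of h, symmetric]) (simp only: sum scaleR)
    also have "norm \<dots> \<le> (\<Sum>b\<in>Basis. norm h * norm (frechet_derivative f (at x) b))"
      by (intro sum_norm_le) (simp add: Basis_le_norm mult_right_mono)
    also have "\<dots> \<le> C * norm h"
      using mult_right_mono[OF order_trans[OF abs_ge_self C(2)[OF x, unfolded real_norm_def]] norm_ge_zero[of h]]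
      by (simp add: sum_distrib_left[symmetric] mult.commute)
    finally show "norm (frechet_derivative f (at x) h) \<le> C * norm h" .
  qed
  then have "C-lipschitz_on (cball 0 r) f"
    using C(1) smooth_imp_differentiable[OF assms]
    by (intro bounded_derivative_imp_lipschitz[where f' = "\<lambda>x. frechet_derivative f (at x)"])
      (auto intro: has_derivative_at_withinI simp: frechet_derivative_works)
  then show "\<exists>C. C-lipschitz_on B f" using r lipschitz_on_subset by blast
qed

section \<open>Differentiability of vectors and determinants through their entries\<close>

lemma has_derivative_vec_componentwise:
  fixes f :: "'a::real_normed_vector \<Rightarrow> 'b::euclidean_space^'n"
  assumes "\<And>i. ((\<lambda>x. f x $ i) has_derivative (\<lambda>h. f' h $ i)) (at x within S)"
  shows "(f has_derivative f') (at x within S)"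
  using assms
  by (subst has_derivative_componentwise_within)
    (auto simp: Basis_vec_def inner_axis intro!: has_derivative_inner_left)

lemma differentiable_vec:
  fixes f :: "'a::real_normed_vector \<Rightarrow> 'b::euclidean_space^'n"
  assumes "\<And>i. (\<lambda>x. f x $ i) differentiable (at x)"
  shows "f differentiable (at x)"
  unfolding differentiable_def
  by (rule exI[of _ "\<lambda>h. \<chi> i. frechet_derivative (\<lambda>x. f x $ i) (at x) h"],
      rule has_derivative_vec_componentwise)
    (use assms in \<open>simp add: frechet_derivative_works\<close>)

text \<open>By the Leibniz formula the determinant is a polynomial in the entries.\<close>

lemma differentiable_det:
  fixes M :: "'a::euclidean_space \<Rightarrow> real^'n^'n"
  assumes "\<And>i j. (\<lambda>x. M x $ i $ j) differentiable (at x)"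
  shows "(\<lambda>x. det (M x)) differentiable (at x)"
proof -
  have "\<exists>D. ((\<lambda>x. M x $ i $ j) has_derivative D) (at x)" for i j
    using assms by (auto simp: differentiable_def)
  then obtain D where D: "\<And>i j. ((\<lambda>x. M x $ i $ j) has_derivative D i j) (at x)" by metis
  show ?thesis
    unfolding det_def differentiable_def
    by (rule exI, rule has_derivative_sum, rule has_derivative_mult, rule has_derivative_const,
        rule has_derivative_prod, rule D)
qed

text \<open>Mean value inequality for the deviation from the linearization at \<open>a\<close>: the
  derivative \<open>\<phi>'\<close> differs from its value at \<open>a\<close> by at most
  \<open>C * (b - a)\<close>. The constant is \<open>C\<close> instead of the sharp
  \<open>C / 2\<close>, which suffices for a second-order bound.\<close>

lemma has_vector_derivative_lipschitz_remainder:
  fixes \<phi> :: "real \<Rightarrow> 'a::real_normed_vector"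
  assumes \<phi>: "\<And>u. u \<in> {a..b} \<Longrightarrow> (\<phi> has_vector_derivative \<phi>' u) (at u within {a..b})"
    and C: "C-lipschitz_on {a..b} \<phi>'" and "a \<le> b"
  shows "norm (\<phi> b - \<phi> a - (b - a) *\<^sub>R \<phi>' a) \<le> C * (b - a)\<^sup>2"
proof -
  have "norm (\<phi> b - \<phi> a - (b - a) *\<^sub>R \<phi>' a) \<le> norm (b - a) * (C * (b - a))"
  proof (rule vector_differentiable_bound_linearization[OF \<phi>])
    fix u assume u: "u \<in> {a..b}"
    have "norm (\<phi>' u - \<phi>' a) \<le> C * norm (u - a)"
      using u \<open>a \<le> b\<close> by (intro lipschitz_on_normD[OF C]) auto
    also have "\<dots> \<le> C * (b - a)"
      using u lipschitz_on_nonneg[OF C] by (intro mult_left_mono) auto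
    finally show "norm (\<phi>' u - \<phi>' a) \<le> C * (b - a)" .
  qed (use \<open>a \<le> b\<close> in \<open>auto simp: closed_segment_eq_real_ivl\<close>)
  then show ?thesis using \<open>a \<le> b\<close> by (simp add: power2_eq_square mult_ac)
qed

text \<open>On a compact time interval the continuous solution stays in a bounded set, where the
  field \<open>\<Phi>\<close> is bounded. So the derivative of \<open>y\<close> is bounded there,
  and the mean value inequality applies.\<close>

lemma bdd_lipschitz_autonomous_solution:
  fixes y :: "real \<Rightarrow> 'a::real_normed_vector"
  assumes \<Phi>: "bdd_lipschitz UNIV \<Phi>"
    and y: "\<And>s. s \<ge> 0 \<Longrightarrow> (y has_vector_derivative \<Phi> (y s)) (at s within {0..})"
  shows "bdd_lipschitz {0..} y"
proof (rule bdd_lipschitzI)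
  fix B :: "real set" assume B: "B \<subseteq> {0..}" "bounded B"
  from B obtain r where r: "B \<subseteq> {0..r}"
    by (force simp: bounded_iff subset_eq)
  have y': "(y has_vector_derivative \<Phi> (y s)) (at s within {0..r})" if "s \<in> {0..r}" for s
    using y[of s] that by (auto intro: has_vector_derivative_within_subset)
  then have "continuous_on {0..r} y"
    by (meson continuous_on_eq_continuous_within has_vector_derivative_continuous)
  then have "bounded (y ` {0..r})"
    by (intro compact_imp_bounded compact_continuous_image compact_Icc)
  then obtain b where b: "b > 0" "\<And>z. z \<in> y ` {0..r} \<Longrightarrow> norm (\<Phi> z) \<le> b"
    using bdd_lipschitz_bound[OF \<Phi> subset_UNIV] by metis
  have "b-lipschitz_on {0..r} y"
  proof (rule bounded_derivative_imp_lipschitz)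
    show "(y has_derivative (\<lambda>h. h *\<^sub>R \<Phi> (y s))) (at s within {0..r})" if "s \<in> {0..r}" for s
      using y'[OF that] by (simp add: has_vector_derivative_def)
    show "onorm (\<lambda>h. h *\<^sub>R \<Phi> (y s)) \<le> b" if "s \<in> {0..r}" for s
      using b(2)[of "y s"] that by (intro onorm_le) (simp add: mult.commute[of b] mult_left_mono)
  qed (use b in auto)
  then show "\<exists>C. C-lipschitz_on B y" using r lipschitz_on_subset by blast
qed

subsection \<open>Derivatives of the Jacobian and of inverse matrices\<close>

lemma
  assumes "invertible A"
  shows matrix_inv_right: "A ** matrix_inv A = mat 1"
    and matrix_inv_left: "matrix_inv A ** A = mat 1"
proof -
  have "A ** matrix_inv A = mat 1 \<and> matrix_inv A ** A = mat 1"
    using assms unfolding invertible_def matrix_inv_def by (rule someI_ex)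
  then show "A ** matrix_inv A = mat 1" "matrix_inv A ** A = mat 1" by auto
qed

text \<open>Cramer's rule writes the entries of the inverse as quotients of determinants. This gives
  differentiability alone; the formula for the derivative follows separately.\<close>

lemma differentiable_matrix_inv:
  fixes M :: "'a::euclidean_space \<Rightarrow> real^'n^'n"
  assumes "M differentiable (at x)" "\<And>y. invertible (M y)"
  shows "(\<lambda>y. matrix_inv (M y)) differentiable (at x)"
proof -
  obtain D where D: "(M has_derivative D) (at x)"
    using assms(1) by (auto simp: differentiable_def)
  have entry: "(\<lambda>y. M y $ i $ j) differentiable (at x)" for i j
    using bounded_linear.has_derivative[OF bounded_linear_vec_nth
        bounded_linear.has_derivative[OF bounded_linear_vec_nth D]]
    by (rule differentiableI)
  \<comment> \<open>Column \<open>k\<close> of the inverse solves the linear system with right-hand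
    side the \<open>k\<close>-th unit vector.\<close>
  have "matrix_inv (M y) $ i $ k = det (\<chi> a b. if b = i then axis k 1 $ a else M y $ a $ b) / det (M y)"
    for y i k
  proof -
    have "M y *v column k (matrix_inv (M y)) = axis k 1"
      using assms(2)[of y] matrix_inv_right[of "M y"]
      by (metis matrix_vector_mul_assoc matrix_vector_mul_lid matrix_vector_mult_basis)
    then have "column k (matrix_inv (M y)) =
        (\<chi> i. det (\<chi> a b. if b = i then axis k 1 $ a else M y $ a $ b) / det (M y))"
      using cramer[of "M y"] assms(2)[of y] by (simp add: invertible_det_nz)
    then show ?thesis by (simp add: column_def vec_eq_iff)
  qed
  moreover have "(\<lambda>y. det (\<chi> a b. if b = i then axis k 1 $ a else M y $ a $ b) / det (M y))
    differentiable (at x)" for i k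
  proof (intro differentiable_divide differentiable_det)
    show "(\<lambda>y. (\<chi> a b. if b = i then axis k 1 $ a else M y $ a $ b) $ a $ b) differentiable (at x)"
      for a b
      using entry by (cases "b = i") simp_all
  qed (use assms(2) entry in \<open>simp_all add: invertible_det_nz\<close>)
  ultimately show ?thesis
    by (intro differentiable_vec) simp
qed

text \<open>Some derivative \<open>D\<close> exists, so differentiating
  \<open>M y ** matrix_inv (M y) = mat 1\<close> gives an equation that determines it.\<close>

lemma has_derivative_matrix_inv:
  fixes M :: "'a::euclidean_space \<Rightarrow> real^'n^'n"
  assumes M: "(M has_derivative M') (at x)" and inv: "\<And>y. invertible (M y)"
  shows "((\<lambda>y. matrix_inv (M y)) has_derivative
    (\<lambda>h. - (matrix_inv (M x) ** M' h ** matrix_inv (M x)))) (at x)"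
proof -
  obtain D where D: "((\<lambda>y. matrix_inv (M y)) has_derivative D) (at x)"
    using differentiable_matrix_inv[of M x, OF _ inv] M by (auto simp: differentiable_def)
  have "((\<lambda>y. M y ** matrix_inv (M y)) has_derivative
      (\<lambda>h. M x ** D h + M' h ** matrix_inv (M x))) (at x)"
    by (rule bounded_bilinear.FDERIV[OF bounded_bilinear_matrix_mult M D])
  moreover have "((\<lambda>y. M y ** matrix_inv (M y)) has_derivative (\<lambda>h. 0)) (at x)"
    by (simp add: matrix_inv_right[OF inv])
  ultimately have "(\<lambda>h. M x ** D h + M' h ** matrix_inv (M x)) = (\<lambda>h. 0)"
    by (rule has_derivative_unique)
  then have "M x ** D h + M' h ** matrix_inv (M x) = 0" for h
    by (rule fun_cong)
  then have "matrix_inv (M x) ** (M x ** D h + M' h ** matrix_inv (M x)) = 0" for h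
    by (simp add: matrix_matrix_mult_def zero_vec_def)
  then have "D h + matrix_inv (M x) ** M' h ** matrix_inv (M x) = 0" for h
    by (simp add: matrix_add_ldistrib matrix_mul_assoc matrix_inv_left[OF inv])
  then have "D = (\<lambda>h. - (matrix_inv (M x) ** M' h ** matrix_inv (M x)))"
    by (simp add: fun_eq_iff eq_neg_iff_add_eq_0)
  with D show ?thesis by simp
qed

text \<open>The resolvent identity expresses the difference of two inverses as a product of both
  inverses with the difference of the matrices. The inverses are bounded on \<open>B\<close> by
  continuity on a compact ball.\<close>

lemma bdd_lipschitz_matrix_inv:
  fixes M :: "'a::euclidean_space \<Rightarrow> real^'n^'n"
  assumes M: "bdd_lipschitz UNIV M" and diff: "\<And>x. M differentiable (at x)"
    and inv: "\<And>y. invertible (M y)"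
  shows "bdd_lipschitz UNIV (\<lambda>y. matrix_inv (M y))"
proof (rule bdd_lipschitzI)
  fix B :: "'a set" assume B: "bounded B"
  obtain C where C: "C-lipschitz_on B M" using M B by (rule bdd_lipschitzE[OF _ subset_UNIV])
  obtain r where r: "B \<subseteq> cball 0 r" using B by (auto simp: bounded_iff subset_eq)
  have "continuous_on (cball 0 r) (\<lambda>y. matrix_inv (M y))"
    using differentiable_matrix_inv[OF diff inv]
    by (auto intro!: continuous_at_imp_continuous_on differentiable_imp_continuous_within)
  then have "bounded ((\<lambda>y. matrix_inv (M y)) ` cball 0 r)"
    by (intro compact_imp_bounded compact_continuous_image compact_cball)
  then obtain b where b: "b > 0" "\<And>y. y \<in> B \<Longrightarrow> norm (matrix_inv (M y)) \<le> b"
    unfolding bounded_pos using r by blast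
  obtain K where K: "K > 0" "\<And>(A::real^'n^'n) (A'::real^'n^'n). norm (A ** A') \<le> norm A * norm A' * K"
    using bounded_bilinear.pos_bounded[OF bounded_bilinear_matrix_mult] by blast
  have "dist (matrix_inv (M x)) (matrix_inv (M y)) \<le> (b * C * K * b * K) * dist x y"
    if xy: "x \<in> B" "y \<in> B" for x y
  proof -
    interpret bounded_bilinear "(**) :: real^'n^'n \<Rightarrow> real^'n^'n \<Rightarrow> real^'n^'n"
      by (rule bounded_bilinear_matrix_mult)
    have "matrix_inv (M x) - matrix_inv (M y) = matrix_inv (M x) ** (M y - M x) ** matrix_inv (M y)"
      by (simp add: diff_left diff_right matrix_inv_left[OF inv] matrix_mul_assoc[symmetric]
          matrix_inv_right[OF inv])
    then have "dist (matrix_inv (M x)) (matrix_inv (M y))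
        \<le> norm (matrix_inv (M x) ** (M y - M x)) * norm (matrix_inv (M y)) * K"
      using K(2) by (simp add: dist_norm)
    also have "\<dots> \<le> (norm (matrix_inv (M x)) * norm (M y - M x) * K) * norm (matrix_inv (M y)) * K"
      using K by (intro mult_right_mono) auto
    also have "\<dots> \<le> (b * (C * norm (y - x)) * K) * b * K"
      using b xy lipschitz_on_normD[OF C xy(2,1)] lipschitz_on_nonneg[OF C] K(1)
      by (intro mult_mono) auto
    finally show ?thesis by (simp add: dist_norm norm_minus_commute mult_ac)
  qed
  moreover have "0 \<le> b * C * K * b * K"
    using b(1) K(1) lipschitz_on_nonneg[OF C] by simp
  ultimately show "\<exists>C. C-lipschitz_on B (\<lambda>y. matrix_inv (M y))" by (blast intro: lipschitz_onI)
qed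

section \<open>The Jacobian and its derivative\<close>

lemma frechet_derivative_nth:
  fixes f :: "'a::real_normed_vector \<Rightarrow> 'b::real_normed_vector^'n"
  assumes "f differentiable (at x)"
  shows "frechet_derivative (\<lambda>y. f y $ i) (at x) u = frechet_derivative f (at x) u $ i"
proof -
  have "((\<lambda>y. f y $ i) has_derivative (\<lambda>u. frechet_derivative f (at x) u $ i)) (at x)"
    using assms
    by (intro bounded_linear.has_derivative[OF bounded_linear_vec_nth]) (simp add: frechet_derivative_works)
  from frechet_derivative_at[OF this] show ?thesis by metis
qed

lemma Jac_nth: "Jac f x $ i $ j = frechet_derivative f (at x) (axis j 1) $ i"
  by (simp add: Jac_def jacobian_def matrix_def)

lemma hessian_nth:
  fixes f :: "real^'n \<Rightarrow> real^'m"
  assumes "smooth f"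
  shows "hessian (\<lambda>y. f y $ i) x $ a $ b =
    frechet_derivative (\<lambda>y. frechet_derivative f (at y) (axis b 1)) (at x) (axis a 1) $ i"
  by (simp add: hessian_def frechet_derivative_nth smooth_imp_differentiable
      smooth_frechet_derivative assms)

lemma matrix_Hbil_nth:
  "matrix (Hbil f x w) $ i $ j = (\<Sum>a\<in>UNIV. w $ a * hessian (\<lambda>y. f y $ i) x $ a $ j)"
  by (simp add: matrix_def Hbil_def inner_vec_def matrix_vector_mult_basis column_def)

text \<open>Entry \<open>(i, j)\<close> of the Jacobian is a directional derivative along the
  \<open>j\<close>-th axis. Expanding \<open>w\<close> in the standard basis in its own derivative
  gives the sum in \<open>matrix_Hbil_nth\<close>: \<open>w\<close> enters the outer differentiation
  of \<open>hessian\<close> and \<open>j\<close> the inner one.\<close>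

lemma has_derivative_Jac:
  fixes f :: "real^'n \<Rightarrow> real^'m"
  assumes "smooth f"
  shows "(Jac f has_derivative (\<lambda>w. matrix (Hbil f x w))) (at x)"
proof (intro has_derivative_vec_componentwise)
  fix i j
  let ?g = "\<lambda>y. frechet_derivative f (at y) (axis j 1)"
  have g: "?g differentiable (at x)"
    by (intro smooth_imp_differentiable smooth_frechet_derivative assms)
  then interpret bounded_linear "frechet_derivative ?g (at x)"
    using frechet_derivative_works has_derivative_bounded_linear by blast
  have "frechet_derivative ?g (at x) w $ i = matrix (Hbil f x w) $ i $ j" for w
  proof -
    have "frechet_derivative ?g (at x) w = (\<Sum>a\<in>UNIV. w $ a *\<^sub>R frechet_derivative ?g (at x) (axis a 1))"
      by (subst basis_expansion[of w, symmetric])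
        (simp only: sum scaleR scalar_mult_eq_scaleR)
    then show ?thesis by (simp add: matrix_Hbil_nth hessian_nth assms)
  qed
  moreover have "((\<lambda>y. ?g y $ i) has_derivative (\<lambda>w. frechet_derivative ?g (at x) w $ i)) (at x)"
    using g by (intro bounded_linear.has_derivative[OF bounded_linear_vec_nth])
      (simp add: frechet_derivative_works)
  ultimately show "((\<lambda>y. Jac f y $ i $ j) has_derivative (\<lambda>w. matrix (Hbil f x w) $ i $ j)) (at x)"
    by (simp add: Jac_nth)
qed

lemma bdd_lipschitz_Jac:
  fixes f :: "real^'n \<Rightarrow> real^'m"
  assumes "smooth f"
  shows "bdd_lipschitz UNIV (Jac f)"
  by (intro bdd_lipschitz_vec, unfold Jac_nth)
    (intro bdd_lipschitz_linear[OF bounded_linear_vec_nth] smooth_imp_bdd_lipschitz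
      smooth_frechet_derivative assms)

lemma bdd_lipschitz_matrix_Hbil:
  fixes f :: "real^'n \<Rightarrow> real^'m"
  assumes "smooth f" "bdd_lipschitz S X" "bdd_lipschitz S W"
  shows "bdd_lipschitz S (\<lambda>s. matrix (Hbil f (X s) (W s)))"
  using assms
  by (intro bdd_lipschitz_vec, unfold matrix_Hbil_nth hessian_nth[OF assms(1)])
    (intro bdd_lipschitz_intros bdd_lipschitz_compose[OF _ assms(2) subset_UNIV] smooth_imp_bdd_lipschitz
      smooth_frechet_derivative | simp)+

lemmas matrix_mult_ring_simps =
  bounded_bilinear.add_left[OF bounded_bilinear_matrix_mult]
  bounded_bilinear.add_right[OF bounded_bilinear_matrix_mult]
  bounded_bilinear.diff_left[OF bounded_bilinear_matrix_mult]
  bounded_bilinear.diff_right[OF bounded_bilinear_matrix_mult]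
  bounded_bilinear.minus_left[OF bounded_bilinear_matrix_mult]
  bounded_bilinear.minus_right[OF bounded_bilinear_matrix_mult]
  matrix_mul_assoc

lemma transpose_diff: "transpose (A - B) = transpose A - transpose B" for A B :: "real^'a^'b"
  by (rule linear_diff[OF bounded_linear.linear[OF bounded_linear_transpose]])

subsection \<open>The projections of a submersion\<close>

locale submersion =
  fixes f :: "real^'n \<Rightarrow> real^'m"
  assumes smooth: "smooth f" and rank_Jac: "\<And>x. rank (Jac f x) = CARD('m)"
begin

text \<open>The quadratic form of the Gram matrix at \<open>y\<close> is the squared length of
  \<open>transpose (Jac f x) *v y\<close>, and full rank makes the transpose injective. Hence the
  kernel is trivial.\<close>

lemma invertible_gram: "invertible (Jac f x ** transpose (Jac f x))"
proof -
  have inj: "inj ((*v) (transpose (Jac f x)))"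
    by (simp only: full_rank_injective[symmetric] rank_transpose rank_Jac)
  have "y = 0" if y: "(Jac f x ** transpose (Jac f x)) *v y = 0" for y
  proof -
    have "(transpose (Jac f x) *v y) \<bullet> (transpose (Jac f x) *v y)
        = y \<bullet> ((Jac f x ** transpose (Jac f x)) *v y)"
      by (simp add: matrix_vector_mul_assoc[symmetric] dot_lmul_matrix del: matrix_vector_mul_assoc)
    then have "transpose (Jac f x) *v y = transpose (Jac f x) *v 0" using y by simp
    then show "y = 0" by (rule injD[OF inj])
  qed
  then show ?thesis by (simp add: invertible_left_inverse matrix_left_invertible_ker)
qed

definition gram_inv :: "real^'n \<Rightarrow> real^'m^'m" where
  "gram_inv x = matrix_inv (Jac f x ** transpose (Jac f x))"

lemma Jac_pinv_eq: "Jac_pinv f x = transpose (Jac f x) ** gram_inv x"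
  by (simp add: Jac_pinv_def gram_inv_def)

lemma Nproj_eq: "Nproj f x = transpose (Jac f x) ** gram_inv x ** Jac f x"
  by (simp add: Nproj_def Jac_pinv_eq)

text \<open>The Gram matrix is symmetric, so multiplying the transposed inverse by
  \<open>?M ** gram_inv x = mat 1\<close> returns the inverse itself.\<close>

lemma transpose_gram_inv: "transpose (gram_inv x) = gram_inv x"
proof -
  let ?M = "Jac f x ** transpose (Jac f x)"
  have "transpose (gram_inv x) = transpose (gram_inv x) ** (?M ** gram_inv x)"
    by (simp add: gram_inv_def matrix_inv_right[OF invertible_gram])
  also have "\<dots> = transpose (?M ** gram_inv x) ** gram_inv x"
    by (simp add: matrix_transpose_mul matrix_mul_assoc)
  also have "\<dots> = gram_inv x"
    by (simp add: gram_inv_def matrix_inv_right[OF invertible_gram])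
  finally show ?thesis .
qed

section \<open>Algebra of the projections and of the two halves of the derivative of
  \<open>Nproj f\<close>\<close>

lemma Jac_Jac_pinv: "Jac f x ** Jac_pinv f x = mat 1"
  by (simp add: Jac_pinv_eq matrix_mul_assoc gram_inv_def matrix_inv_right[OF invertible_gram])

lemma transpose_Nproj: "transpose (Nproj f x) = Nproj f x"
  by (simp add: Nproj_eq matrix_transpose_mul transpose_gram_inv matrix_mul_assoc)

lemma Nproj_Jac_pinv: "Nproj f x ** Jac_pinv f x = Jac_pinv f x"
  by (simp add: Nproj_def matrix_mul_assoc[symmetric] Jac_Jac_pinv)

lemma Nproj_idem: "Nproj f x ** Nproj f x = Nproj f x"
  by (metis Nproj_Jac_pinv Nproj_def matrix_mul_assoc)

lemma Tproj_Nproj: "Tproj f x ** Nproj f x = 0"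
  by (simp add: Tproj_def matrix_mult_ring_simps Nproj_idem)

lemma Tproj_idem: "Tproj f x ** Tproj f x = Tproj f x"
  using Tproj_Nproj[of x] by (subst (2) Tproj_def) (simp add: matrix_mult_ring_simps)

lemma Nproj_dN_perp: "Nproj f x ** dN_perp f x w = dN_perp f x w"
  by (simp add: dN_perp_def matrix_mul_assoc Nproj_Jac_pinv)

lemma dN_perp_Tproj: "dN_perp f x w ** Tproj f x = dN_perp f x w"
  by (simp add: dN_perp_def matrix_mul_assoc[symmetric] Tproj_idem)

lemma dN_perp_Nproj: "dN_perp f x w ** Nproj f x = 0"
  by (simp add: dN_perp_def matrix_mul_assoc[symmetric] Tproj_Nproj)

text \<open>Transpose of \<open>Nproj_dN_perp\<close>, because \<open>Nproj f x\<close> is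
  symmetric. The next lemma arises from \<open>dN_perp_Nproj\<close> in the same way.\<close>

lemma dN_par_Nproj: "dN_par f x w ** Nproj f x = dN_par f x w"
  using arg_cong[OF Nproj_dN_perp, of transpose]
  by (simp add: dN_par_def matrix_transpose_mul transpose_Nproj)

lemma Nproj_dN_par: "Nproj f x ** dN_par f x w = 0"
  using arg_cong[OF dN_perp_Nproj, of transpose]
  by (simp add: dN_par_def matrix_transpose_mul transpose_Nproj
      linear_0[OF bounded_linear.linear[OF bounded_linear_transpose]])

lemma dN_par_Tproj: "dN_par f x w ** Tproj f x = 0"
  by (simp add: Tproj_def matrix_mult_ring_simps dN_par_Nproj)

text \<open>Linearity in the direction comes from \<open>matrix (Hbil f x w)\<close>, which is
  linear in \<open>w\<close> as the derivative of the Jacobian.\<close>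

lemma linear_dN_perp: "linear (dN_perp f x)"
proof -
  have lin: "linear (\<lambda>w. matrix (Hbil f x w))"
    using has_derivative_Jac[OF smooth] by (rule has_derivative_linear)
  show ?thesis
    by (intro linearI) (simp_all add: dN_perp_def linear_add[OF lin] linear_scale[OF lin] matrix_mult_ring_simps
        bounded_bilinear.scaleR_left[OF bounded_bilinear_matrix_mult]
        bounded_bilinear.scaleR_right[OF bounded_bilinear_matrix_mult])
qed

lemma linear_dN_par: "linear (dN_par f x)"
  using linear_compose[OF linear_dN_perp bounded_linear.linear[OF bounded_linear_transpose], of x]
  by (simp add: o_def dN_par_def[abs_def])

text \<open>The Golub--Pereyra formula.\<close>
lemma has_derivative_Nproj:
  "(Nproj f has_derivative (\<lambda>w. dN_perp f x w + dN_par f x w)) (at x)"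
proof -
  let ?J = "Jac f x" and ?K = "\<lambda>w. matrix (Hbil f x w)" and ?P = "gram_inv x"
  note mult = bounded_bilinear.FDERIV[OF bounded_bilinear_matrix_mult]
  note J = has_derivative_Jac[OF smooth, of x]
  note Jt = bounded_linear.has_derivative[OF bounded_linear_transpose J]
  have P: "(gram_inv has_derivative
      (\<lambda>w. - (?P ** (?J ** transpose (?K w) + ?K w ** transpose ?J) ** ?P))) (at x)"
    unfolding gram_inv_def[abs_def] by (rule has_derivative_matrix_inv[OF mult[OF J Jt] invertible_gram])
  \<comment> \<open>The right-hand side is the product rule for the three factors of
    \<open>Nproj\<close>. The derivative of \<open>gram_inv\<close> contributes two terms: one with
    \<open>?K w\<close>, which completes \<open>transpose ?J ** ?P ** ?K w\<close> to
    \<open>dN_perp\<close>, and one with its transpose, which completes the remaining term to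
    \<open>dN_par\<close>.\<close>
  have "(\<lambda>w. dN_perp f x w + dN_par f x w) = (\<lambda>w. transpose ?J ** ?P ** ?K w +
      (transpose ?J ** - (?P ** (?J ** transpose (?K w) + ?K w ** transpose ?J) ** ?P)
        + transpose (?K w) ** ?P) ** ?J)"
    by (simp add: fun_eq_iff dN_par_def dN_perp_def matrix_transpose_mul transpose_diff Jac_pinv_eq
        transpose_gram_inv Tproj_def Nproj_eq matrix_mult_ring_simps)
  with mult[OF mult[OF Jt P] J] show ?thesis
    by (simp add: Nproj_eq[abs_def])
qed

section \<open>Lipschitz bounds for the projections and their derivatives\<close>

lemma bdd_lipschitz_gram_inv: "bdd_lipschitz UNIV gram_inv"
  unfolding gram_inv_def[abs_def]
proof (rule bdd_lipschitz_matrix_inv[OF _ _ invertible_gram])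
  show "bdd_lipschitz UNIV (\<lambda>x. Jac f x ** transpose (Jac f x))"
    by (intro bdd_lipschitz_intros bdd_lipschitz_Jac smooth)
  show "(\<lambda>x. Jac f x ** transpose (Jac f x)) differentiable (at x)" for x
    using bounded_bilinear.FDERIV[OF bounded_bilinear_matrix_mult has_derivative_Jac[OF smooth]
        bounded_linear.has_derivative[OF bounded_linear_transpose has_derivative_Jac[OF smooth]]]
    by (rule differentiableI)
qed

lemma bdd_lipschitz_Jac_pinv: "bdd_lipschitz UNIV (Jac_pinv f)"
  unfolding Jac_pinv_eq[abs_def]
  by (intro bdd_lipschitz_intros bdd_lipschitz_gram_inv bdd_lipschitz_Jac smooth)

lemma bdd_lipschitz_Nproj: "bdd_lipschitz S X \<Longrightarrow> bdd_lipschitz S (\<lambda>s. Nproj f (X s))"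
  unfolding Nproj_def[abs_def]
  by (intro bdd_lipschitz_intros bdd_lipschitz_compose[OF bdd_lipschitz_Jac_pinv _ subset_UNIV]
      bdd_lipschitz_compose[OF bdd_lipschitz_Jac _ subset_UNIV] smooth)

lemma bdd_lipschitz_Tproj: "bdd_lipschitz S X \<Longrightarrow> bdd_lipschitz S (\<lambda>s. Tproj f (X s))"
  unfolding Tproj_def by (intro bdd_lipschitz_intros bdd_lipschitz_Nproj)

lemma bdd_lipschitz_dN_perp:
  "bdd_lipschitz S X \<Longrightarrow> bdd_lipschitz S W \<Longrightarrow> bdd_lipschitz S (\<lambda>s. dN_perp f (X s) (W s))"
  unfolding dN_perp_def
  by (intro bdd_lipschitz_intros bdd_lipschitz_compose[OF bdd_lipschitz_Jac_pinv _ subset_UNIV]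
      bdd_lipschitz_Tproj bdd_lipschitz_matrix_Hbil smooth)

lemma bdd_lipschitz_dN_par:
  "bdd_lipschitz S X \<Longrightarrow> bdd_lipschitz S W \<Longrightarrow> bdd_lipschitz S (\<lambda>s. dN_par f (X s) (W s))"
  unfolding dN_par_def by (intro bdd_lipschitz_intros bdd_lipschitz_dN_perp)

lemmas bdd_lipschitz_proj_intros = bdd_lipschitz_intros bdd_lipschitz_Nproj bdd_lipschitz_Tproj
  bdd_lipschitz_dN_perp bdd_lipschitz_dN_par
  bdd_lipschitz_bounded_linear[OF bounded_linear_fst]
  bdd_lipschitz_bounded_linear[OF bounded_linear_snd]

section \<open>Expansion of the projection along a straight step\<close>

lemma Nproj_step_zeroth_order:
  obtains C where "\<And>X V h. norm X \<le> r \<Longrightarrow> norm V \<le> r \<Longrightarrow> 0 \<le> h \<Longrightarrow> h \<le> 1 \<Longrightarrow>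
    norm (Nproj f (X + h *\<^sub>R V) *v V - Nproj f X *v V) \<le> C * h"
proof -
  \<comment> \<open>For \<open>h \<le> 1\<close> the point \<open>X + h *\<^sub>R V\<close> has norm
    at most \<open>r + r\<close>, so one set \<open>D\<close>, and one constant, serves all
    admissible \<open>X\<close>, \<open>V\<close> and \<open>h\<close>.\<close>
  define D where "D = cball (0::real^'n) (2 * r) \<times> cball (0::real^'n) r"
  have "bdd_lipschitz UNIV (\<lambda>z. Nproj f (fst z) *v snd z)"
    by (intro bdd_lipschitz_proj_intros)
  moreover have "bounded D" by (simp add: D_def bounded_Times)
  ultimately obtain C where C: "C-lipschitz_on D (\<lambda>z. Nproj f (fst z) *v snd z)"
    by (rule bdd_lipschitzE[OF _ subset_UNIV])
  have "norm (Nproj f (X + h *\<^sub>R V) *v V - Nproj f X *v V) \<le> C * r * h"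
    if b: "norm X \<le> r" "norm V \<le> r" "0 \<le> h" "h \<le> 1" for X V :: "real^'n" and h
  proof -
    have "(X + u *\<^sub>R V, V) \<in> D" if u: "0 \<le> u" "u \<le> 1" for u
      using norm_triangle_ineq[of X "u *\<^sub>R V"] mult_mono[of u 1 "norm V" r] b u by (simp add: D_def)
    from this[of h] this[of 0] have "(X + h *\<^sub>R V, V) \<in> D" "(X, V) \<in> D" using b by auto
    from lipschitz_on_normD[OF C this]
    have "norm (Nproj f (X + h *\<^sub>R V) *v V - Nproj f X *v V) \<le> C * (h * norm V)"
      using b by (simp add: norm_Pair)
    also have "\<dots> \<le> C * (h * r)"
      using b lipschitz_on_nonneg[OF C] by (intro mult_left_mono) auto
    finally show ?thesis by (simp add: mult_ac)
  qed
  then show thesis by (rule that)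
qed

text \<open>With \<open>X\<close> and \<open>V\<close> frozen, the curve obtained by varying the
  step length has derivative \<open>\<Psi> (X + u *\<^sub>R V, V)\<close> by the Golub--Pereyra
  formula. This is Lipschitz in \<open>u\<close>, so the one-variable remainder estimate applies,
  with a constant depending on \<open>r\<close> only.\<close>

lemma Nproj_step_first_order:
  obtains C where "\<And>X V h. norm X \<le> r \<Longrightarrow> norm V \<le> r \<Longrightarrow> 0 \<le> h \<Longrightarrow> h \<le> 1 \<Longrightarrow>
    norm (Nproj f (X + h *\<^sub>R V) *v V - Nproj f X *v V
      - h *\<^sub>R ((dN_perp f X V + dN_par f X V) *v V)) \<le> C * h\<^sup>2"
proof -
  define D where "D = cball (0::real^'n) (2 * r) \<times> cball (0::real^'n) r"
  define \<Psi> where "\<Psi> z = (dN_perp f (fst z) (snd z) + dN_par f (fst z) (snd z)) *v snd z" for z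
  have "bdd_lipschitz UNIV \<Psi>"
    unfolding \<Psi>_def by (intro bdd_lipschitz_proj_intros)
  moreover have "bounded D" by (simp add: D_def bounded_Times)
  ultimately obtain C where C: "C-lipschitz_on D \<Psi>"
    by (rule bdd_lipschitzE[OF _ subset_UNIV])
  have "norm (Nproj f (X + h *\<^sub>R V) *v V - Nproj f X *v V - h *\<^sub>R \<Psi> (X, V)) \<le> C * r * h\<^sup>2"
    if b: "norm X \<le> r" "norm V \<le> r" "0 \<le> h" "h \<le> 1" for X V :: "real^'n" and h
  proof -
    have D: "(X + u *\<^sub>R V, V) \<in> D" if u: "u \<in> {0..h}" for u
      using norm_triangle_ineq[of X "u *\<^sub>R V"] mult_mono[of u 1 "norm V" r] b u by (simp add: D_def)
    \<comment> \<open>The factor \<open>r\<close> bounds the speed \<open>norm V\<close> of the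
      straight line.\<close>
    have lip: "(C * r)-lipschitz_on {0..h} (\<lambda>u. \<Psi> (X + u *\<^sub>R V, V))"
    proof (rule lipschitz_onI)
      fix u w assume uw: "u \<in> {0..h}" "w \<in> {0..h}"
      have "dist (\<Psi> (X + u *\<^sub>R V, V)) (\<Psi> (X + w *\<^sub>R V, V)) \<le> C * (norm V * dist u w)"
        using lipschitz_on_normD[OF C D[OF uw(1)] D[OF uw(2)]]
        by (simp add: dist_norm norm_Pair scaleR_diff_left[symmetric] mult.commute)
      also have "\<dots> \<le> C * (r * dist u w)"
        using b lipschitz_on_nonneg[OF C] by (intro mult_left_mono mult_right_mono) auto
      finally show "dist (\<Psi> (X + u *\<^sub>R V, V)) (\<Psi> (X + w *\<^sub>R V, V)) \<le> C * r * dist u w"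
        by (simp add: mult_ac)
    next
      show "0 \<le> C * r"
        using lipschitz_on_nonneg[OF C] order_trans[OF norm_ge_zero b(1)] by simp
    qed
    have der: "((\<lambda>u. Nproj f (X + u *\<^sub>R V) *v V) has_vector_derivative \<Psi> (X + u *\<^sub>R V, V))
        (at u within {0..h})" for u
    proof -
      have "((\<lambda>u. X + u *\<^sub>R V) has_vector_derivative V) (at u within {0..h})"
        by (auto intro!: derivative_eq_intros)
      from vector_derivative_diff_chain_within[OF this has_derivative_at_withinI[OF has_derivative_Nproj]]
      have "((\<lambda>u. Nproj f (X + u *\<^sub>R V)) has_vector_derivative
          dN_perp f (X + u *\<^sub>R V) V + dN_par f (X + u *\<^sub>R V) V) (at u within {0..h})"
        by (simp add: o_def)
      from bounded_bilinear.has_vector_derivative[OF bounded_bilinear_matrix_vector_mult this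
          has_vector_derivative_const[of V]]
      show ?thesis by (simp add: \<Psi>_def)
    qed
    show ?thesis
      using has_vector_derivative_lipschitz_remainder[OF der lip \<open>0 \<le> h\<close>] by simp
  qed
  then show thesis by (intro that) (simp add: \<Psi>_def)
qed

end

subsection \<open>Splitting the flow\<close>

locale submersion_flow = submersion f for f :: "real^'n \<Rightarrow> real^'m" +
  fixes x v :: "real \<Rightarrow> real^'n"
  assumes x_deriv: "\<And>s. s \<ge> 0 \<Longrightarrow> (x has_vector_derivative Tproj f (x s) *v v s) (at s within {0..})"
    and v_deriv: "\<And>s. s \<ge> 0 \<Longrightarrow> (v has_vector_derivative
        (dN_par f (x s) ((Tproj f (x s) - Nproj f (x s)) *v v s)
         - dN_perp f (x s) ((Tproj f (x s) - Nproj f (x s)) *v v s)) *v v s) (at s within {0..})"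
begin

definition p :: "real \<Rightarrow> real^'n" where "p s = Tproj f (x s) *v v s"
definition q :: "real \<Rightarrow> real^'n" where "q s = Nproj f (x s) *v v s"

lemma v_eq: "v s = p s + q s"
  by (simp add: p_def q_def Tproj_def matrix_vector_mult_diff_rdistrib)

lemma Nproj_p: "Nproj f (x s) *v p s = 0"
  by (simp add: p_def Tproj_def matrix_vector_mul_assoc matrix_mult_ring_simps Nproj_idem)

lemma Nproj_q: "Nproj f (x s) *v q s = q s"
  by (simp add: q_def matrix_vector_mul_assoc Nproj_idem)

lemma dN_perp_v: "dN_perp f (x s) w *v v s = dN_perp f (x s) w *v p s"
  by (simp add: p_def matrix_vector_mul_assoc dN_perp_Tproj)

lemma dN_perp_q: "dN_perp f (x s) w *v q s = 0"
  by (simp add: q_def matrix_vector_mul_assoc dN_perp_Nproj)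

lemma dN_par_v: "dN_par f (x s) w *v v s = dN_par f (x s) w *v q s"
  by (simp add: q_def matrix_vector_mul_assoc dN_par_Nproj)

lemma dN_par_p: "dN_par f (x s) w *v p s = 0"
  by (simp add: p_def matrix_vector_mul_assoc dN_par_Tproj)

text \<open>The two equations are coupled, so the pair is treated as one solution of the autonomous
  system with field \<open>\<Phi>\<close>.\<close>

lemma bdd_lipschitz_solution: "bdd_lipschitz {0..} x" "bdd_lipschitz {0..} v"
proof -
  define \<Phi> where "\<Phi> z = (Tproj f (fst z) *v snd z,
    (dN_par f (fst z) ((Tproj f (fst z) - Nproj f (fst z)) *v snd z)
     - dN_perp f (fst z) ((Tproj f (fst z) - Nproj f (fst z)) *v snd z)) *v snd z)" for z
  have "bdd_lipschitz UNIV \<Phi>"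
    unfolding \<Phi>_def by (intro bdd_lipschitz_proj_intros)
  moreover have "((\<lambda>s. (x s, v s)) has_vector_derivative \<Phi> (x s, v s)) (at s within {0..})"
    if "s \<ge> 0" for s
    using has_vector_derivative_Pair[OF x_deriv[OF that] v_deriv[OF that]] by (simp add: \<Phi>_def)
  ultimately have *: "bdd_lipschitz {0..} (\<lambda>s. (x s, v s))"
    by (rule bdd_lipschitz_autonomous_solution)
  show "bdd_lipschitz {0..} x" "bdd_lipschitz {0..} v"
    using bdd_lipschitz_linear[OF bounded_linear_fst *] bdd_lipschitz_linear[OF bounded_linear_snd *]
    by simp_all
qed

lemma bdd_lipschitz_p: "bdd_lipschitz {0..} p" and bdd_lipschitz_q: "bdd_lipschitz {0..} q"
  unfolding p_def[abs_def] q_def[abs_def]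
  by (intro bdd_lipschitz_proj_intros bdd_lipschitz_solution)+

definition q' :: "real \<Rightarrow> real^'n" where
  "q' s = dN_perp f (x s) (q s) *v v s + dN_par f (x s) (p s) *v v s"

definition p' :: "real \<Rightarrow> real^'n" where
  "p' s = - (dN_par f (x s) (q s) *v v s) - dN_perp f (x s) (p s) *v v s"

lemma v_deriv_pq:
  assumes "s \<ge> 0"
  shows "(v has_vector_derivative
    dN_par f (x s) (p s) *v v s - dN_par f (x s) (q s) *v v s
    - dN_perp f (x s) (p s) *v v s + dN_perp f (x s) (q s) *v v s) (at s within {0..})"
  using v_deriv[OF assms]
  by (simp add: matrix_vector_mult_diff_rdistrib p_def[symmetric] q_def[symmetric]
      linear_diff[OF linear_dN_perp] linear_diff[OF linear_dN_par] algebra_simps)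

text \<open>The product rule for \<open>Nproj f (x s) *v v s\<close> gives \<open>dN_perp\<close>
  and \<open>dN_par\<close> in direction \<open>p s\<close> applied to \<open>v s\<close>, plus the
  projection of the derivative of \<open>v\<close>. The projection removes the \<open>dN_par\<close>
  terms there, and the two \<open>dN_perp\<close> terms in direction \<open>p s\<close>
  cancel.\<close>

lemma has_vector_derivative_q:
  assumes "s \<ge> 0"
  shows "(q has_vector_derivative q' s) (at s within {0..})"
proof -
  have "((\<lambda>s. Nproj f (x s)) has_vector_derivative dN_perp f (x s) (p s) + dN_par f (x s) (p s))
      (at s within {0..})"
    using vector_derivative_diff_chain_within[OF x_deriv[OF assms]
        has_derivative_at_withinI[OF has_derivative_Nproj]]
    by (simp add: o_def p_def)
  from bounded_bilinear.has_vector_derivative[OF bounded_bilinear_matrix_vector_mult this v_deriv_pq[OF assms]]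
  show ?thesis
    by (simp add: q_def[abs_def, symmetric] q'_def matrix_vector_mul_assoc
        matrix_vector_right_distrib matrix_vector_mult_diff_distrib
        matrix_vector_mult_add_rdistrib Nproj_dN_par Nproj_dN_perp algebra_simps)
qed

lemma has_vector_derivative_p:
  assumes "s \<ge> 0"
  shows "(p has_vector_derivative p' s) (at s within {0..})"
proof -
  have "p = (\<lambda>s. v s - q s)" by (simp add: fun_eq_iff v_eq)
  then show ?thesis
    using has_vector_derivative_diff[OF v_deriv_pq[OF assms] has_vector_derivative_q[OF assms]]
    by (simp add: p'_def q'_def algebra_simps)
qed

lemma bdd_lipschitz_p': "bdd_lipschitz {0..} p'" and bdd_lipschitz_q': "bdd_lipschitz {0..} q'"
  unfolding p'_def[abs_def] q'_def[abs_def]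
  by (intro bdd_lipschitz_proj_intros bdd_lipschitz_solution bdd_lipschitz_p bdd_lipschitz_q)+

section \<open>Truncation errors of a single step\<close>

lemma flow_first_order:
  fixes y :: "real \<Rightarrow> 'a::real_normed_vector"
  assumes y: "\<And>s. s \<ge> 0 \<Longrightarrow> (y has_vector_derivative y' s) (at s within {0..})"
    and y': "bdd_lipschitz {0..} y'"
  obtains C where "\<And>s \<delta>. 0 \<le> s \<Longrightarrow> 0 \<le> \<delta> \<Longrightarrow> s + \<delta> \<le> R \<Longrightarrow>
    norm (y (s + \<delta>) - y s - \<delta> *\<^sub>R y' s) \<le> C * \<delta>\<^sup>2"
proof -
  \<comment> \<open>The constant is taken on the whole interval up to the horizon \<open>R\<close>,
    which makes it uniform in the starting time \<open>s\<close> and the step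
    \<open>\<delta>\<close>.\<close>
  obtain C where C: "C-lipschitz_on {0..R} y'"
    using y' by (rule bdd_lipschitzE[of _ _ "{0..R}"]) auto
  have "norm (y (s + \<delta>) - y s - \<delta> *\<^sub>R y' s) \<le> C * \<delta>\<^sup>2"
    if "0 \<le> s" "0 \<le> \<delta>" "s + \<delta> \<le> R" for s \<delta>
  proof -
    have "C-lipschitz_on {s..s + \<delta>} y'"
      using C by (rule lipschitz_on_subset) (use that in auto)
    moreover have "(y has_vector_derivative y' u) (at u within {s..s + \<delta>})" if "u \<in> {s..s + \<delta>}" for u
      using y[of u] that \<open>0 \<le> s\<close> by (auto intro: has_vector_derivative_within_subset)
    ultimately show ?thesis
      using has_vector_derivative_lipschitz_remainder[of s "s + \<delta>" y y' C] \<open>0 \<le> \<delta>\<close> by simp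
  qed
  then show thesis by (rule that)
qed

text \<open>The sign stands for the alternating factor \<open>(-1) ^ k\<close>. Keeping it as a
  parameter leaves a differentiable function of time; passing to the next step replaces
  \<open>\<epsilon>\<close> by \<open>-\<epsilon>\<close>.\<close>

definition step_velocity :: "real \<Rightarrow> real \<Rightarrow> real^'n" where
  "step_velocity \<epsilon> s = p s + \<epsilon> *\<^sub>R q s"

text \<open>In the position error the projection is already multiplied by \<open>\<delta>\<close>,
  so its zeroth-order estimate suffices. The velocity error needs the first-order expansion, whose
  linear term must cancel against the derivative of
  \<open>step_velocity (-\<epsilon>)\<close>.\<close>

lemma truncation_bounds:
  assumes \<epsilon>: "\<epsilon>\<^sup>2 = 1"
  obtains C where "\<And>s \<delta>. 0 \<le> s \<Longrightarrow> 0 < \<delta> \<Longrightarrow> \<delta> \<le> 1 \<Longrightarrow> s + \<delta> \<le> R \<Longrightarrow>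
      norm (x (s + \<delta>) - x s
        - \<delta> *\<^sub>R (Tproj f (x s + (\<delta> / 2) *\<^sub>R step_velocity \<epsilon> s) *v step_velocity \<epsilon> s)) \<le> C * \<delta>\<^sup>2"
    and "\<And>s \<delta>. 0 \<le> s \<Longrightarrow> 0 < \<delta> \<Longrightarrow> \<delta> \<le> 1 \<Longrightarrow> s + \<delta> \<le> R \<Longrightarrow>
      norm (step_velocity (-\<epsilon>) (s + \<delta>)
        - (mat 1 - 2 *\<^sub>R Nproj f (x s + (\<delta> / 2) *\<^sub>R step_velocity \<epsilon> s)) *v step_velocity \<epsilon> s) \<le> C * \<delta>\<^sup>2"
proof -
  let ?V = "step_velocity \<epsilon>"
  have "bdd_lipschitz {0..} (\<lambda>s. (x s, ?V s))"
    unfolding step_velocity_def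
    by (intro bdd_lipschitz_proj_intros bdd_lipschitz_solution bdd_lipschitz_p bdd_lipschitz_q)
  then obtain r where r: "\<And>s. s \<in> {0..R} \<Longrightarrow> norm (x s, ?V s) \<le> r"
    by (rule bdd_lipschitz_bound[of _ _ "{0..R}"]) auto
  have xV: "norm (x s) \<le> r" "norm (?V s) \<le> r" if "s \<in> {0..R}" for s
    using r[OF that] norm_fst_le[of "x s" "?V s"] norm_snd_le[of "?V s" "x s"] by auto
  obtain C0 where C0: "\<And>X V h. norm X \<le> r \<Longrightarrow> norm V \<le> r \<Longrightarrow> 0 \<le> h \<Longrightarrow> h \<le> 1 \<Longrightarrow>
      norm (Nproj f (X + h *\<^sub>R V) *v V - Nproj f X *v V) \<le> C0 * h"
    using Nproj_step_zeroth_order by blast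
  obtain C1 where C1: "\<And>X V h. norm X \<le> r \<Longrightarrow> norm V \<le> r \<Longrightarrow> 0 \<le> h \<Longrightarrow> h \<le> 1 \<Longrightarrow>
      norm (Nproj f (X + h *\<^sub>R V) *v V - Nproj f X *v V
        - h *\<^sub>R ((dN_perp f X V + dN_par f X V) *v V)) \<le> C1 * h\<^sup>2"
    using Nproj_step_first_order by blast
  obtain Cx where Cx: "\<And>s \<delta>. 0 \<le> s \<Longrightarrow> 0 \<le> \<delta> \<Longrightarrow> s + \<delta> \<le> R \<Longrightarrow>
      norm (x (s + \<delta>) - x s - \<delta> *\<^sub>R p s) \<le> Cx * \<delta>\<^sup>2"
    using flow_first_order[of x p R] x_deriv bdd_lipschitz_p by (auto simp: p_def)
  have "(step_velocity (-\<epsilon>) has_vector_derivative p' s - \<epsilon> *\<^sub>R q' s) (at s within {0..})"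
    if "s \<ge> 0" for s
    unfolding step_velocity_def[abs_def]
    by (auto intro!: derivative_eq_intros has_vector_derivative_p[OF that] has_vector_derivative_q[OF that])
  moreover have "bdd_lipschitz {0..} (\<lambda>s. p' s - \<epsilon> *\<^sub>R q' s)"
    by (intro bdd_lipschitz_intros bdd_lipschitz_p' bdd_lipschitz_q')
  ultimately obtain Cv where Cv: "\<And>s \<delta>. 0 \<le> s \<Longrightarrow> 0 \<le> \<delta> \<Longrightarrow> s + \<delta> \<le> R \<Longrightarrow>
      norm (step_velocity (-\<epsilon>) (s + \<delta>) - step_velocity (-\<epsilon>) s - \<delta> *\<^sub>R (p' s - \<epsilon> *\<^sub>R q' s)) \<le> Cv * \<delta>\<^sup>2"
    using flow_first_order[of "step_velocity (-\<epsilon>)" "\<lambda>s. p' s - \<epsilon> *\<^sub>R q' s" R] by blast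
  \<comment> \<open>Consequently, at \<open>x s\<close> itself, the tangential part of
    \<open>?V s\<close> is \<open>p s\<close> and its reflection is
    \<open>step_velocity (-\<epsilon>) s\<close>.\<close>
  have NV: "Nproj f (x s) *v ?V s = \<epsilon> *\<^sub>R q s" for s
    by (simp add: step_velocity_def matrix_vector_right_distrib matrix_vector_mult_scaleR Nproj_p Nproj_q)
  \<comment> \<open>The halves come from the midpoint step \<open>h = \<delta> / 2\<close>: the
    projection errors enter as \<open>\<delta> * (C0 * h)\<close> and
    \<open>2 * (C1 * h\<^sup>2)\<close>.\<close>
  define C where "C = max (Cx + C0 / 2) (Cv + C1 / 2)"
  show thesis
  proof (rule that)
    fix s \<delta> :: real
    assume s: "0 \<le> s" and \<delta>: "0 < \<delta>" "\<delta> \<le> 1" and R: "s + \<delta> \<le> R"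
    have sR: "s \<in> {0..R}" and h: "0 \<le> \<delta> / 2" "\<delta> / 2 \<le> 1" using s \<delta> R by auto
    define W where "W = Nproj f (x s + (\<delta> / 2) *\<^sub>R ?V s) *v ?V s"
    have "x (s + \<delta>) - x s - \<delta> *\<^sub>R (Tproj f (x s + (\<delta> / 2) *\<^sub>R ?V s) *v ?V s)
        = (x (s + \<delta>) - x s - \<delta> *\<^sub>R p s) + \<delta> *\<^sub>R (W - Nproj f (x s) *v ?V s)"
      unfolding NV
      by (simp add: Tproj_def W_def matrix_vector_mult_diff_rdistrib step_velocity_def algebra_simps)
    also have "norm \<dots> \<le> Cx * \<delta>\<^sup>2 + \<delta> * (C0 * (\<delta> / 2))"
      using Cx[of s \<delta>] C0[OF xV[OF sR] h] s \<delta> R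
      by (intro norm_triangle_le add_mono) (auto simp: W_def)
    also have "\<dots> = (Cx + C0 / 2) * \<delta>\<^sup>2" by (simp add: power2_eq_square algebra_simps)
    also have "\<dots> \<le> C * \<delta>\<^sup>2" by (intro mult_right_mono) (simp_all add: C_def)
    finally show "norm (x (s + \<delta>) - x s
        - \<delta> *\<^sub>R (Tproj f (x s + (\<delta> / 2) *\<^sub>R ?V s) *v ?V s)) \<le> C * \<delta>\<^sup>2" .
    let ?A = "dN_perp f (x s)" and ?B = "dN_par f (x s)"
    \<comment> \<open>\<open>?A\<close> annihilates the \<open>q\<close> part and \<open>?B\<close>
      the \<open>p\<close> part of the vector, so each can be rewritten as acting on
      \<open>v s\<close>, with the factor \<open>\<epsilon>\<close> only at
      \<open>?B\<close>.\<close>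
    have "(?A (?V s) + ?B (?V s)) *v ?V s = ?A (?V s) *v v s + \<epsilon> *\<^sub>R (?B (?V s) *v v s)"
      by (simp add: step_velocity_def matrix_vector_mult_add_rdistrib matrix_vector_right_distrib
          matrix_vector_mult_scaleR dN_perp_v dN_perp_q dN_par_v dN_par_p)
    \<comment> \<open>Expanding the direction \<open>?V s\<close> gives four terms; the one with
      \<open>?B (q s)\<close> carries the factor \<open>\<epsilon>\<^sup>2 = 1\<close>.\<close>
    also have "\<dots> = - (p' s - \<epsilon> *\<^sub>R q' s)"
      using \<epsilon> by (simp add: step_velocity_def p'_def q'_def linear_add[OF linear_dN_perp]
          linear_add[OF linear_dN_par] linear_scale[OF linear_dN_perp] linear_scale[OF linear_dN_par]
          matrix_vector_mult_add_rdistrib scaleR_matrix_vector_assoc[symmetric] power2_eq_square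
          scaleR_add_right)
    finally have quad: "(?A (?V s) + ?B (?V s)) *v ?V s = - (p' s - \<epsilon> *\<^sub>R q' s)" .
    \<comment> \<open>Twice the half step is \<open>\<delta>\<close>, so by \<open>quad\<close> the
      linear terms of the two brackets cancel and both brackets are second-order remainders.\<close>
    have "step_velocity (-\<epsilon>) (s + \<delta>) - (mat 1 - 2 *\<^sub>R Nproj f (x s + (\<delta> / 2) *\<^sub>R ?V s)) *v ?V s
        = (step_velocity (-\<epsilon>) (s + \<delta>) - step_velocity (-\<epsilon>) s - \<delta> *\<^sub>R (p' s - \<epsilon> *\<^sub>R q' s))
          + 2 *\<^sub>R (W - Nproj f (x s) *v ?V s - (\<delta> / 2) *\<^sub>R ((?A (?V s) + ?B (?V s)) *v ?V s))"
      unfolding NV quad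
      by (simp add: W_def matrix_vector_mult_diff_rdistrib step_velocity_def
          scaleR_matrix_vector_assoc[symmetric] algebra_simps) (simp add: vec_eq_iff)
    also have "norm \<dots> \<le> Cv * \<delta>\<^sup>2 + 2 * (C1 * (\<delta> / 2)\<^sup>2)"
      using Cv[of s \<delta>] C1[OF xV[OF sR] h] s \<delta> R
      by (intro norm_triangle_le add_mono) (auto simp: W_def)
    also have "\<dots> = (Cv + C1 / 2) * \<delta>\<^sup>2" by (simp add: power2_eq_square algebra_simps)
    also have "\<dots> \<le> C * \<delta>\<^sup>2" by (intro mult_right_mono) (simp_all add: C_def)
    finally show "norm (step_velocity (-\<epsilon>) (s + \<delta>)
        - (mat 1 - 2 *\<^sub>R Nproj f (x s + (\<delta> / 2) *\<^sub>R ?V s)) *v ?V s) \<le> C * \<delta>\<^sup>2" .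
  qed
qed

end

section \<open>From uniform one-step bounds to the asymptotic statement\<close>

theorem theorem5:
  fixes f :: "real^'n \<Rightarrow> real^'m"
    and x v v_par v_perp :: "real \<Rightarrow> real^'n"
    and X V \<sigma> \<tau> :: "real \<Rightarrow> nat \<Rightarrow> real^'n"
    and t :: real
  assumes "CARD('n) \<ge> 2" and "0 < CARD('m)" and "CARD('m) < CARD('n)"
    and "smooth f"
    and "\<And>y. rank (Jac f y) = CARD('m)"
    and "\<And>s. s \<ge> 0 \<Longrightarrow> (x has_vector_derivative Tproj f (x s) *v v s) (at s within {0..})"
    and "\<And>s. s \<ge> 0 \<Longrightarrow>
      (v has_vector_derivative
        (dN_par f (x s) ((Tproj f (x s) - Nproj f (x s)) *v v s)
         - dN_perp f (x s) ((Tproj f (x s) - Nproj f (x s)) *v v s)) *v v s) (at s within {0..})"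
    and "\<And>s. s \<ge> 0 \<Longrightarrow> v_par s = Tproj f (x s) *v v s"
    and "\<And>s. s \<ge> 0 \<Longrightarrow> v_perp s = Nproj f (x s) *v v s"
    and "\<And>\<delta> k. \<delta> > 0 \<Longrightarrow> X \<delta> k = x (real k * \<delta>)"
    and "\<And>\<delta> k. \<delta> > 0 \<Longrightarrow> V \<delta> k = v_par (real k * \<delta>) + (-1) ^ k *\<^sub>R v_perp (real k * \<delta>)"
    and "\<And>\<delta> k. \<delta> > 0 \<Longrightarrow>
      \<sigma> \<delta> (Suc k) = X \<delta> (Suc k) - X \<delta> k - \<delta> *\<^sub>R (Tproj f (X \<delta> k + (\<delta> / 2) *\<^sub>R V \<delta> k) *v V \<delta> k)"
    and "\<And>\<delta> k. \<delta> > 0 \<Longrightarrow>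
      \<tau> \<delta> (Suc k) = V \<delta> (Suc k) - (mat 1 - 2 *\<^sub>R Nproj f (X \<delta> k + (\<delta> / 2) *\<^sub>R V \<delta> k)) *v V \<delta> k"
    and "t \<ge> 0"
  shows "(\<lambda>(\<delta>, k). norm (\<sigma> \<delta> k)) \<in> O[step_filter t](\<lambda>(\<delta>, k). \<delta>\<^sup>2)
       \<and> (\<lambda>(\<delta>, k). norm (\<tau> \<delta> k)) \<in> O[step_filter t](\<lambda>(\<delta>, k). \<delta>\<^sup>2)"
proof -
  interpret submersion_flow f x v
    using assms(4-7) by unfold_locales
  \<comment> \<open>The horizon \<open>t + 1\<close> covers all times within distance 1 of
    \<open>t\<close>. The alternating sign takes only two values, so the larger of two constants is
    independent of \<open>k\<close>.\<close>
  obtain C1 where C1: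
    "\<And>s \<delta>. 0 \<le> s \<Longrightarrow> 0 < \<delta> \<Longrightarrow> \<delta> \<le> 1 \<Longrightarrow> s + \<delta> \<le> t + 1 \<Longrightarrow> norm (x (s + \<delta>) - x s
        - \<delta> *\<^sub>R (Tproj f (x s + (\<delta> / 2) *\<^sub>R step_velocity 1 s) *v step_velocity 1 s)) \<le> C1 * \<delta>\<^sup>2"
    "\<And>s \<delta>. 0 \<le> s \<Longrightarrow> 0 < \<delta> \<Longrightarrow> \<delta> \<le> 1 \<Longrightarrow> s + \<delta> \<le> t + 1 \<Longrightarrow> norm (step_velocity (- 1) (s + \<delta>)
        - (mat 1 - 2 *\<^sub>R Nproj f (x s + (\<delta> / 2) *\<^sub>R step_velocity 1 s)) *v step_velocity 1 s) \<le> C1 * \<delta>\<^sup>2"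
    using truncation_bounds[of 1 "t + 1"] by auto
  obtain C2 where C2:
    "\<And>s \<delta>. 0 \<le> s \<Longrightarrow> 0 < \<delta> \<Longrightarrow> \<delta> \<le> 1 \<Longrightarrow> s + \<delta> \<le> t + 1 \<Longrightarrow> norm (x (s + \<delta>) - x s
        - \<delta> *\<^sub>R (Tproj f (x s + (\<delta> / 2) *\<^sub>R step_velocity (- 1) s) *v step_velocity (- 1) s)) \<le> C2 * \<delta>\<^sup>2"
    "\<And>s \<delta>. 0 \<le> s \<Longrightarrow> 0 < \<delta> \<Longrightarrow> \<delta> \<le> 1 \<Longrightarrow> s + \<delta> \<le> t + 1 \<Longrightarrow> norm (step_velocity 1 (s + \<delta>)
        - (mat 1 - 2 *\<^sub>R Nproj f (x s + (\<delta> / 2) *\<^sub>R step_velocity (- 1) s)) *v step_velocity (- 1) s)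
        \<le> C2 * \<delta>\<^sup>2"
    using truncation_bounds[of "- 1" "t + 1"] by auto
  define C where "C = max C1 C2"
  have C: "C1 * \<delta>\<^sup>2 \<le> C * \<delta>\<^sup>2" "C2 * \<delta>\<^sup>2 \<le> C * \<delta>\<^sup>2" for \<delta> :: real
    by (auto simp: C_def intro: mult_right_mono)
  have V: "V \<delta> k = step_velocity ((- 1) ^ k) (real k * \<delta>)" if "\<delta> > 0" for \<delta> k
    using that assms(8,9,11) by (simp add: step_velocity_def p_def q_def)
  have bounds: "norm (\<sigma> \<delta> k) \<le> C * \<delta>\<^sup>2 \<and> norm (\<tau> \<delta> k) \<le> C * \<delta>\<^sup>2"
    if \<delta>: "0 < \<delta>" "\<delta> < 1" and k: "1 \<le> k" "\<bar>real k * \<delta> - t\<bar> < 1" for \<delta> k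
  proof -
    \<comment> \<open>The errors are prescribed at successor indices only, whence
      \<open>1 \<le> k\<close>. The step ending at \<open>k\<close> starts at time
      \<open>real j * \<delta>\<close>.\<close>
    obtain j where j: "k = Suc j" using k by (cases k) auto
    have s: "0 \<le> real j * \<delta>" "real j * \<delta> + \<delta> \<le> t + 1" and Suc: "real (Suc j) * \<delta> = real j * \<delta> + \<delta>"
      using \<delta> k j by (auto simp: algebra_simps)
    have \<sigma>: "\<sigma> \<delta> k = x (real j * \<delta> + \<delta>) - x (real j * \<delta>) - \<delta> *\<^sub>R
        (Tproj f (x (real j * \<delta>) + (\<delta> / 2) *\<^sub>R step_velocity ((- 1) ^ j) (real j * \<delta>))
          *v step_velocity ((- 1) ^ j) (real j * \<delta>))"
      unfolding j assms(12)[OF \<delta>(1)] assms(10)[OF \<delta>(1)] V[OF \<delta>(1)] Suc by (rule refl)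
    have \<tau>: "\<tau> \<delta> k = step_velocity (- ((- 1) ^ j)) (real j * \<delta> + \<delta>) -
        (mat 1 - 2 *\<^sub>R Nproj f (x (real j * \<delta>) + (\<delta> / 2) *\<^sub>R step_velocity ((- 1) ^ j) (real j * \<delta>)))
          *v step_velocity ((- 1) ^ j) (real j * \<delta>)"
      unfolding j assms(13)[OF \<delta>(1)] assms(10)[OF \<delta>(1)] V[OF \<delta>(1)] Suc by simp
    \<comment> \<open>The parity of \<open>j\<close> fixes the sign at the start of the step and so
      selects the constant.\<close>
    show ?thesis
      using C1[OF s(1) \<delta>(1) _ s(2)] C2[OF s(1) \<delta>(1) _ s(2)] C[of \<delta>] \<delta>(2)
      unfolding \<sigma> \<tau> by (cases "even j") (auto intro: order_trans)
  qed
  have ev: "eventually (\<lambda>(\<delta>, k). norm (\<sigma> \<delta> k) \<le> C * \<delta>\<^sup>2 \<and> norm (\<tau> \<delta> k) \<le> C * \<delta>\<^sup>2) (step_filter t)"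
    unfolding eventually_step_filter
    by (rule exI[of _ 1], intro conjI exI[of _ 1]) (use bounds in auto)
  show ?thesis
    by (intro conjI; rule bigoI[of _ C]; rule eventually_mono[OF ev]) auto
qed

end
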